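(* Let $m\in\mathbb{N}$, $n\in\mathbb{N}_0$, $x_1,\ldots,x_m\in\mathbb{R}$. For $j=1,\ldots,m$ let $A^{(j)}(x)=(A^{(j)}_n(x))_{n\ge0}$ be a sequence of polynomials with $\sum_{n\ge0}A^{(j)}_n(x)\frac{z^n}{n!}=e^{xz}/\mathbb{E}e^{zY^{(j)}}$ for $|z|$ small, where $Y^{(j)}$ is a real random variable with $\mathbb{E}e^{s_j|Y^{(j)}|}<\infty$ for some $s_j>0$, and suppose $Y^{(1)},\ldots,Y^{(m)}$ are mutually independent. Let $\boldsymbol{W}=(W_1,\ldots,W_m)$ be a random vector (components not necessarily independent) such that $\mathbb{E}e^{t_j|W_j|}<\infty$ for some $t_j>0$, $j=1,\ldots,m$. Then $$\sum_{j_1+\cdots+j_m=n}\binom{n}{j_1,\ldots,j_m}\mathbb{E}\big(W_1^{j_1}\cdots W_m^{j_m}\big)A^{(1)}_{j_1}(x_1)\cdots A^{(m)}_{j_m}(x_m)$$ $$=\sum_{r=0}^n\binom nr\sum_{k=0}^r\binom{r+1}{k+1}(-1)^k\sum_{i_1+\cdots+i_m=r}\binom{r}{i_1,\ldots,i_m}\mathbb{E}\Big(W_1^{i_1}\cdots W_m^{i_m}(x_1W_1+\cdots+x_mW_m)^{n-r}\Big)\,\mathbb{E}(S^{(1)}_k)^{i_1}\cdots\mathbb{E}(S^{(m)}_k)^{i_m}.$$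
   Context: For each $j$, let $(Y^{(j)}_l)_{l\ge1}$ be independent copies of $Y^{(j)}$ and $S^{(j)}_k=Y^{(j)}_1+\cdots+Y^{(j)}_k$ for $k\in\mathbb{N}$, $S^{(j)}_0=0$. Convention $0^0=1$. *)

theory Defs
  imports "HOL-Probability.Probability" "HOL-Computational_Algebra.Polynomial"
begin

text \<open>Multi-indices \<open>(j\<^sub>1, \<dots>, j\<^sub>m)\<close> of weight \<open>n\<close>; values outside \<open>{1..m}\<close> are
  pinned to \<^const>\<open>undefined\<close> by \<open>\<rightarrow>\<^sub>E\<close>, so that each multi-index occurs exactly once.\<close>
definition multi_indices :: "nat \<Rightarrow> nat \<Rightarrow> (nat \<Rightarrow> nat) set" where
  "multi_indices m n = {j \<in> {1..m} \<rightarrow>\<^sub>E UNIV. (\<Sum>i=1..m. j i) = n}"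

definition multinomial :: "nat \<Rightarrow> nat \<Rightarrow> (nat \<Rightarrow> nat) \<Rightarrow> real" where
  "multinomial m n j = fact n / (\<Prod>i=1..m. fact (j i))"

text \<open>\<open>Z 1, Z 2, \<dots>\<close> are independent copies of the random variable \<open>Y\<close>. They may live on a
  probability space other than that of \<open>Y\<close>, which need not be rich enough to carry them;
  \<open>Z 0\<close> is irrelevant.\<close>
definition independent_copies ::
    "'b measure \<Rightarrow> (nat \<Rightarrow> 'b \<Rightarrow> real) \<Rightarrow> 'a measure \<Rightarrow> ('a \<Rightarrow> real) \<Rightarrow> bool" where
  "independent_copies N Z M Y \<longleftrightarrow>
     prob_space.indep_vars N (\<lambda>_. borel) Z {1..} \<and>
     (\<forall>l\<ge>1. distr N borel (Z l) = distr M borel Y)"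

definition partial_sum :: "(nat \<Rightarrow> 'b \<Rightarrow> real) \<Rightarrow> nat \<Rightarrow> 'b \<Rightarrow> real" where
  "partial_sum Z k \<omega> = (\<Sum>l=1..k. Z l \<omega>)"

text \<open>The generating function identity is required for real \<open>z\<close> near \<open>0\<close>, with a neighbourhood
  that may depend on \<open>x\<close>; this is implied by the identity for complex \<open>z\<close> in a fixed disc.\<close>
definition appell_sequence :: "'a measure \<Rightarrow> ('a \<Rightarrow> real) \<Rightarrow> (nat \<Rightarrow> real poly) \<Rightarrow> bool" where
  "appell_sequence M Y A \<longleftrightarrow>
     (\<forall>x. \<forall>\<^sub>F z in nhds 0. (\<lambda>n. poly (A n) x * (z ^ n / fact n)) sums
        (exp (x * z) / (\<integral>\<omega>. exp (z * Y \<omega>) \<partial>M)))"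

definition exp_moment :: "'a measure \<Rightarrow> ('a \<Rightarrow> real) \<Rightarrow> bool" where
  "exp_moment M Y \<longleftrightarrow> (\<exists>s>0. integrable M (\<lambda>\<omega>. exp (s * \<bar>Y \<omega>\<bar>)))"

end

theory Submission
  imports Defs
begin

text \<open>The identity holds for each fixed value \<open>w\<close> of the vector \<open>W\<close>, and is then integrated term by
  term. Let \<open>F\<^sub>l\<close> be the exponential generating function of the moments of \<open>Y\<^sub>l\<close>, and let \<open>H(t)\<close>
  be the product of the series \<open>F\<^sub>l(w\<^sub>l t)\<close>. Up to the factor \<open>n!\<close>, the left-hand side is the
  coefficient of \<open>t\<^sup>n\<close> in \<open>exp((\<Sum>x\<^sub>l w\<^sub>l) t) / H(t)\<close>. As \<open>H(0) = 1\<close>, the coefficient of \<open>t\<^sup>r\<close> in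
  \<open>1 / H\<close> is a binomial combination of those in \<open>H\<^sup>0, \<dots>, H\<^sup>r\<close>, and \<open>F\<^sub>l\<^sup>k\<close> generates the moments
  of the \<open>k\<close>-th partial sum.\<close>

section \<open>Formal power series\<close>

text \<open>Evaluation at 0 kills the constant coefficient, and the derivative again vanishes near
  0. Its coefficients are those of \<open>F\<close>, shifted and scaled by nonzero integers, so
  induction on the index reaches all of them.\<close>

lemma eval_fps_0D:
  fixes F :: "'a :: {banach, real_normed_field} fps"
  assumes "fps_conv_radius F > 0" "\<forall>\<^sub>F z in nhds 0. eval_fps F z = 0"
  shows "F = 0"
proof (rule fps_ext)
  fix n
  show "fps_nth F n = fps_nth 0 n"
    using assms
  proof (induction n arbitrary: F)
    case 0
    then show ?case
      using eventually_nhds_x_imp_x[OF 0(2)] by (simp add: eval_fps_at_0)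
  next
    case (Suc n)
    have "\<forall>\<^sub>F z in nhds 0. z \<in> eball 0 (fps_conv_radius F)"
      using Suc.prems by (intro eventually_nhds_in_open) (auto simp: zero_ereal_def)
    \<comment> \<open>Differentiating at \<open>z\<close> needs the vanishing on a whole
      neighbourhood of \<open>z\<close>, not only at \<open>z\<close>.\<close>
    moreover have "\<forall>\<^sub>F z in nhds 0. \<forall>\<^sub>F w in nhds z. eval_fps F w = 0"
      using Suc.prems(2) by (simp add: eventually_eventually)
    ultimately have "\<forall>\<^sub>F z in nhds 0. eval_fps (fps_deriv F) z = 0"
    proof eventually_elim
      case (elim z)
      have "(eval_fps F has_field_derivative eval_fps (fps_deriv F) z) (at z)"
        using elim by (intro has_field_derivative_eval_fps) auto
      moreover have "(eval_fps F has_field_derivative 0) (at z)"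
        using DERIV_cong_ev[OF refl elim(2) refl, of 0] by simp
      ultimately show ?case
        by (rule DERIV_unique)
    qed
    moreover have "fps_conv_radius (fps_deriv F) > 0"
      using Suc.prems(1) fps_conv_radius_deriv[of F] by (rule less_le_trans)
    ultimately have "fps_nth (fps_deriv F) n = 0"
      using Suc.IH[of "fps_deriv F"] by simp
    then show ?case by (simp del: of_nat_Suc)
  qed
qed

lemma has_fps_expansion_unique:
  fixes F G :: "'a :: {banach, real_normed_field} fps"
  assumes "f has_fps_expansion F" "f has_fps_expansion G"
  shows "F = G"
  using has_fps_expansion_diff[OF assms] eval_fps_0D[of "F - G"]
  by (simp add: has_fps_expansion_def)

text \<open>Convergence at a single nonzero point already forces a positive radius of convergence;
  half the radius \<open>d\<close> of the given neighbourhood supplies such a point.\<close>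

lemma has_fps_expansionI_sums:
  fixes a :: "nat \<Rightarrow> real"
  assumes "\<forall>\<^sub>F z in nhds 0. (\<lambda>n. a n * z ^ n) sums f z"
  shows "f has_fps_expansion Abs_fps a"
proof -
  obtain d where d: "d > 0" "\<And>z. \<bar>z\<bar> < d \<Longrightarrow> (\<lambda>n. a n * z ^ n) sums f z"
    using assms unfolding eventually_nhds_metric by (auto simp: dist_real_def)
  have "(\<lambda>n. a n * (d / 2) ^ n) sums f (d / 2)"
    using d by auto
  then have "conv_radius a \<ge> norm (d / 2)"
    by (intro conv_radius_geI) (auto simp: sums_iff)
  moreover have "ereal (norm (d / 2)) > 0"
    using d by simp
  ultimately have "conv_radius a > 0"
    by (rule less_le_trans[rotated])
  moreover have "\<forall>\<^sub>F z in nhds 0. eval_fps (Abs_fps a) z = f z"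
    using assms by eventually_elim (auto simp: eval_fps_def sums_iff)
  ultimately show ?thesis
    by (simp add: has_fps_expansion_def fps_conv_radius_def)
qed

section \<open>Coefficients of inverses and products, and the identity for fixed weights\<close>

text \<open>Modulo \<open>t\<close> to the power \<open>r + 1\<close>, the inverse of \<open>H\<close> is the geometric sum \<open>(1 - (1 - H)\<^sup>r\<^sup>+\<^sup>1) / H\<close>,
  which is a polynomial in \<open>H\<close>.\<close>
lemma fps_nth_inverse_binomial:
  fixes H :: "'a :: field fps"
  assumes "fps_nth H 0 = 1"
  shows "fps_nth (inverse H) r =
           (\<Sum>k=0..r. of_nat ((r + 1) choose (k + 1)) * (-1) ^ k * fps_nth (H ^ k) r)"
proof -
  define Q where "Q = (\<Sum>k=0..r. of_nat ((r + 1) choose (k + 1)) * (-1) ^ k * H ^ k)"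
  have "(1 - H) ^ (r + 1) = (- H + 1) ^ (r + 1)"
    by simp
  also have "\<dots> = (\<Sum>k\<le>Suc r. of_nat (Suc r choose k) * (- H) ^ k)"
    by (subst binomial_ring) simp
  \<comment> \<open>Splitting off the term of index 0 shifts the index; this is the source of the
    binomial \<open>(r + 1) choose (k + 1)\<close>.\<close>
  also have "\<dots> = 1 + (\<Sum>k\<le>r. of_nat (Suc r choose Suc k) * (- H) ^ Suc k)"
    by (subst sum.atMost_Suc_shift) simp
  also have "(\<Sum>k\<le>r. of_nat (Suc r choose Suc k) * (- H) ^ Suc k) = - (H * Q)"
    unfolding Q_def sum_distrib_left sum_negf[symmetric] atLeast0AtMost
    by (intro sum.cong refl) (simp add: power_minus[of H] algebra_simps)
  finally have "inverse H * (1 - H) ^ (r + 1) = inverse H * (1 - H * Q)"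
    by simp
  also have "\<dots> = inverse H - (inverse H * H) * Q"
    by (simp add: algebra_simps)
  also have "inverse H * H = 1"
    using assms by (intro inverse_mult_eq_1) simp
  finally have *: "inverse H = Q + inverse H * (1 - H) ^ (r + 1)"
    by simp
  have "fps_nth ((1 - H) ^ (r + 1)) i = 0" if "i \<le> r" for i
    using startsby_zero_power_prefix[of "1 - H" "r + 1"] that assms by auto
  then have "fps_nth (inverse H * (1 - H) ^ (r + 1)) r = 0"
    by (simp add: fps_mult_nth del: power_Suc)
  with * have "fps_nth (inverse H) r = fps_nth Q r"
    by (metis fps_add_nth add.right_neutral)
  also have "\<dots> = (\<Sum>k=0..r. of_nat ((r + 1) choose (k + 1)) * (-1) ^ k * fps_nth (H ^ k) r)"
  proof -
    \<comment> \<open>The scalars in \<open>Q\<close> are themselves series; written with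
      \<open>fps_const\<close> they can be pulled out of the coefficient.\<close>
    have "of_nat a * (-1) ^ k * H ^ k = fps_const (of_nat a * (-1) ^ k) * H ^ k" for a k
      by (simp flip: fps_of_nat fps_const_mult fps_const_power fps_const_neg)
    then show ?thesis
      unfolding Q_def fps_sum_nth by (intro sum.cong refl) (simp only: fps_mult_left_const_nth)
  qed
  finally show ?thesis .
qed

text \<open>An iterated Cauchy product. Extensional functions index the sum so that it matches
  \<open>multi_indices\<close> when \<open>I\<close> is \<open>{1..m}\<close>.\<close>

lemma fps_nth_prod_PiE:
  fixes f :: "'i \<Rightarrow> 'a :: comm_semiring_1 fps"
  assumes "finite I"
  shows "fps_nth (\<Prod>l\<in>I. f l) n =
           (\<Sum>j | j \<in> I \<rightarrow>\<^sub>E UNIV \<and> sum j I = n. \<Prod>l\<in>I. fps_nth (f l) (j l))"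
  using assms
proof (induction I arbitrary: n rule: finite_induct)
  case empty
  show ?case by (auto simp: PiE_empty_domain)
next
  case (insert a I)
  let ?J = "\<lambda>I n. {j :: 'i \<Rightarrow> nat. j \<in> I \<rightarrow>\<^sub>E UNIV \<and> sum j I = n}"
  have fin: "finite (?J I n)" for n
  proof (rule finite_subset)
    have "j i \<le> sum j I" if "i \<in> I" for i and j :: "'i \<Rightarrow> nat"
      using that insert.hyps(1) by (intro member_le_sum) auto
    then show "?J I n \<subseteq> I \<rightarrow>\<^sub>E {..n}"
      by (auto simp: PiE_iff extensional_def)
  qed (use insert.hyps(1) in \<open>auto intro: finite_PiE\<close>)
  have "fps_nth (\<Prod>l\<in>insert a I. f l) n =
      (\<Sum>k=0..n. \<Sum>g\<in>?J I (n - k). fps_nth (f a) k * (\<Prod>l\<in>I. fps_nth (f l) (g l)))"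
    using insert by (simp add: fps_mult_nth sum_distrib_left)
  also have "\<dots> = (\<Sum>(k, g)\<in>(SIGMA k:{0..n}. ?J I (n - k)).
                      fps_nth (f a) k * (\<Prod>l\<in>I. fps_nth (f l) (g l)))"
    by (rule sum.Sigma) (auto simp: fin)
  also have "\<dots> = (\<Sum>j\<in>?J (insert a I) n. \<Prod>l\<in>insert a I. fps_nth (f l) (j l))"
  \<comment> \<open>A multi-index on \<open>insert a I\<close> corresponds to its value at
    \<open>a\<close> together with its restriction to \<open>I\<close>.\<close>
  proof (rule sum.reindex_bij_witness[of _ "\<lambda>j. (j a, restrict j I)" "\<lambda>(k, g). g(a := k)"], goal_cases)
    case (1 p)
    then show ?case
      using insert.hyps by (auto simp: fun_eq_iff restrict_def PiE_iff extensional_def)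
  next
    case (2 p)
    then have "sum (g(a := k)) I = sum g I" for g :: "'i \<Rightarrow> nat" and k
      using insert.hyps by (intro sum.cong) auto
    with 2 show ?case
      using insert.hyps by (auto simp: PiE_iff extensional_def)
  next
    case (3 j)
    then show ?case
      using insert.hyps by (auto simp: fun_eq_iff restrict_def PiE_iff extensional_def)
  next
    case (4 j)
    then show ?case
      using insert.hyps by (auto simp: PiE_iff)
  next
    case (5 p)
    have "(\<Prod>l\<in>I. fps_nth (f l) ((g(a := k)) l)) = (\<Prod>l\<in>I. fps_nth (f l) (g l))" for g k
      using insert.hyps by (intro prod.cong) auto
    then show ?case
      using insert.hyps by (auto split: prod.splits)
  qed
  finally show ?case .
qed

text \<open>The factorials cancel the denominators of the multinomial coefficient, and scaling the
  variable by \<open>w l\<close> produces the powers of \<open>w l\<close>. Both sides of the target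
  identity contain sums of this shape.\<close>

lemma sum_multinomial_fps:
  fixes F :: "nat \<Rightarrow> real fps" and w :: "nat \<Rightarrow> real"
  shows "(\<Sum>i\<in>multi_indices m r. multinomial m r i * (\<Prod>l=1..m. w l ^ i l) *
             (\<Prod>l=1..m. fact (i l) * fps_nth (F l) (i l))) =
           fact r * fps_nth (\<Prod>l=1..m. F l oo (fps_const (w l) * fps_X)) r"
proof -
  have "multinomial m r i * (\<Prod>l=1..m. w l ^ i l) * (\<Prod>l=1..m. fact (i l) * fps_nth (F l) (i l)) =
        fact r * (\<Prod>l=1..m. w l ^ i l * fps_nth (F l) (i l))" for i
    by (simp add: multinomial_def prod.distrib)
  then show ?thesis
    by (simp add: fps_nth_prod_PiE multi_indices_def fps_compose_linear sum_distrib_left)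
qed

lemma fps_nth_0_prod:
  fixes f :: "'i \<Rightarrow> 'a :: comm_ring_1 fps"
  shows "fps_nth (\<Prod>l\<in>I. f l) 0 = (\<Prod>l\<in>I. fps_nth (f l) 0)"
  by (induction I rule: infinite_finite_induct) simp_all

lemma fps_exp_sum:
  fixes c :: "'i \<Rightarrow> 'a :: field_char_0"
  shows "fps_exp (\<Sum>l\<in>I. c l) = (\<Prod>l\<in>I. fps_exp (c l))"
  by (induction I rule: infinite_finite_induct) (simp_all add: fps_exp_add_mult)

text \<open>The deterministic core: \<open>G l\<close> stands for the generating series of the
  Appell polynomials at \<open>x l\<close>, and \<open>F l\<close> for that of the moments of
  \<open>Y l\<close>.\<close>

lemma multinomial_appell_identity:
  fixes F G :: "nat \<Rightarrow> real fps" and w x :: "nat \<Rightarrow> real"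
  assumes GF: "\<And>l. l \<in> {1..m} \<Longrightarrow> G l * F l = fps_exp (x l)"
    and F0: "\<And>l. l \<in> {1..m} \<Longrightarrow> fps_nth (F l) 0 = 1"
  shows "(\<Sum>j\<in>multi_indices m n. multinomial m n j * (\<Prod>l=1..m. w l ^ j l) *
             (\<Prod>l=1..m. fact (j l) * fps_nth (G l) (j l))) =
         (\<Sum>r=0..n. real (n choose r) *
            (\<Sum>k=0..r. real ((r + 1) choose (k + 1)) * (-1) ^ k *
               (\<Sum>i\<in>multi_indices m r.
                  multinomial m r i * ((\<Prod>l=1..m. w l ^ i l) * (\<Sum>l=1..m. x l * w l) ^ (n - r)) *
                  (\<Prod>l=1..m. fact (i l) * fps_nth (F l ^ k) (i l)))))"
proof -
  define s where "s = (\<Sum>l=1..m. x l * w l)"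
  define X where "X l = fps_const (w l) * fps_X" for l
  define H where "H = (\<Prod>l=1..m. F l oo X l)"
  have X0: "fps_nth (X l) 0 = 0" for l
    by (simp add: X_def)
  have H0: "fps_nth H 0 = 1"
    using F0 by (simp add: H_def fps_nth_0_prod)
  \<comment> \<open>Composition with \<open>X l\<close> respects products because \<open>X l\<close>
    has no constant term.\<close>
  have "(\<Prod>l=1..m. G l oo X l) * H = (\<Prod>l=1..m. (G l * F l) oo X l)"
    by (simp add: H_def prod.distrib fps_compose_mult_distrib X0)
  also have "\<dots> = (\<Prod>l=1..m. fps_exp (w l * x l))"
    by (intro prod.cong refl) (simp only: GF X_def fps_exp_compose_linear)
  also have "\<dots> = fps_exp s"
    by (simp add: s_def fps_exp_sum mult.commute)
  finally have "(\<Prod>l=1..m. G l oo X l) * (H * inverse H) = inverse H * fps_exp s"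
    by (simp add: mult_ac)
  also have "H * inverse H = 1"
    using inverse_mult_eq_1[of H] H0 by (simp add: mult.commute)
  finally have PG: "(\<Prod>l=1..m. G l oo X l) = inverse H * fps_exp s"
    by simp
  have Hk: "(\<Prod>l=1..m. F l ^ k oo X l) = H ^ k" for k
    by (simp add: H_def prod_power_distrib fps_compose_power X0)
  have "(\<Sum>j\<in>multi_indices m n. multinomial m n j * (\<Prod>l=1..m. w l ^ j l) *
             (\<Prod>l=1..m. fact (j l) * fps_nth (G l) (j l))) =
        fact n * (\<Sum>r=0..n. fps_nth (inverse H) r * (s ^ (n - r) / fact (n - r)))"
    unfolding sum_multinomial_fps X_def[symmetric] PG by (simp add: fps_mult_nth)
  \<comment> \<open>Here \<open>fact n / fact (n - r)\<close> becomes
    \<open>(n choose r) * fact r\<close>; the factor \<open>fact r\<close> is what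
    \<open>sum_multinomial_fps\<close> absorbs next.\<close>
  also have "\<dots> = (\<Sum>r=0..n. real (n choose r) * (fact r * fps_nth (inverse H) r * s ^ (n - r)))"
    unfolding sum_distrib_left
    by (intro sum.cong refl) (simp add: binomial_fact field_simps)
  also have "\<dots> = (\<Sum>r=0..n. real (n choose r) *
            (\<Sum>k=0..r. real ((r + 1) choose (k + 1)) * (-1) ^ k *
               ((\<Sum>i\<in>multi_indices m r. multinomial m r i * (\<Prod>l=1..m. w l ^ i l) *
                  (\<Prod>l=1..m. fact (i l) * fps_nth (F l ^ k) (i l))) * s ^ (n - r))))"
    unfolding sum_multinomial_fps X_def[symmetric] Hk fps_nth_inverse_binomial[OF H0]
    by (simp add: sum_distrib_left sum_distrib_right mult_ac)
  finally show ?thesis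
    unfolding s_def[symmetric] sum_distrib_right by (simp add: mult_ac)
qed

section \<open>Moments\<close>

text \<open>Products need not inherit a finite exponential moment. This weaker property is closed
  under sums and products without independence, as the possibly dependent components of
  \<open>W\<close> require.\<close>

definition all_moments :: "'a measure \<Rightarrow> ('a \<Rightarrow> real) \<Rightarrow> bool" where
  "all_moments M X \<longleftrightarrow> X \<in> borel_measurable M \<and> (\<forall>n. integrable M (\<lambda>\<omega>. \<bar>X \<omega>\<bar> ^ n))"

lemma all_moments_integrable_power:
  assumes "all_moments M X"
  shows "integrable M (\<lambda>\<omega>. X \<omega> ^ n)"
proof -
  have [measurable]: "X \<in> borel_measurable M" and "integrable M (\<lambda>\<omega>. \<bar>X \<omega>\<bar> ^ n)"
    using assms by (auto simp: all_moments_def)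
  from this(2) show ?thesis
    by (rule Bochner_Integration.integrable_bound) (auto simp: power_abs)
qed

lemma all_moments_integrable: "all_moments M X \<Longrightarrow> integrable M X"
  using all_moments_integrable_power[of M X 1] by simp

lemma (in prob_space) all_moments_const: "all_moments M (\<lambda>_. c)"
  by (simp add: all_moments_def)

lemma all_moments_add:
  assumes "all_moments M X" "all_moments M Y"
  shows "all_moments M (\<lambda>\<omega>. X \<omega> + Y \<omega>)"
  unfolding all_moments_def
proof safe
  have [measurable]: "X \<in> borel_measurable M" "Y \<in> borel_measurable M"
    using assms by (auto simp: all_moments_def)
  show "(\<lambda>\<omega>. X \<omega> + Y \<omega>) \<in> borel_measurable M" by simp
  fix n
  have le: "\<bar>a + b\<bar> ^ n \<le> 2 ^ n * (\<bar>a\<bar> ^ n + \<bar>b\<bar> ^ n)" for a b :: real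
  proof -
    have "\<bar>a + b\<bar> ^ n \<le> (2 * max \<bar>a\<bar> \<bar>b\<bar>) ^ n"
      by (intro power_mono) auto
    also have "\<dots> \<le> 2 ^ n * (\<bar>a\<bar> ^ n + \<bar>b\<bar> ^ n)"
      by (auto simp: power_mult_distrib max_def)
    finally show ?thesis .
  qed
  have "integrable M (\<lambda>\<omega>. 2 ^ n * (\<bar>X \<omega>\<bar> ^ n + \<bar>Y \<omega>\<bar> ^ n))"
    using assms by (auto simp: all_moments_def)
  then show "integrable M (\<lambda>\<omega>. \<bar>X \<omega> + Y \<omega>\<bar> ^ n)"
    by (rule Bochner_Integration.integrable_bound) (use le in \<open>auto simp: power_abs\<close>)
qed

text \<open>By the inequality of arithmetic and geometric means, the \<open>n\<close>-th absolute
  moment of the product is controlled by the moments of order \<open>2 * n\<close> of the factors.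
  The order doubles, hence the demand for all moments at once.\<close>

lemma all_moments_mult:
  assumes "all_moments M X" "all_moments M Y"
  shows "all_moments M (\<lambda>\<omega>. X \<omega> * Y \<omega>)"
  unfolding all_moments_def
proof safe
  have [measurable]: "X \<in> borel_measurable M" "Y \<in> borel_measurable M"
    using assms by (auto simp: all_moments_def)
  show "(\<lambda>\<omega>. X \<omega> * Y \<omega>) \<in> borel_measurable M" by simp
  fix n
  have le: "\<bar>a * b\<bar> ^ n \<le> \<bar>a\<bar> ^ (2 * n) + \<bar>b\<bar> ^ (2 * n)" for a b :: real
  proof -
    have "2 * (\<bar>a\<bar> ^ n * \<bar>b\<bar> ^ n) \<le> (\<bar>a\<bar> ^ n)\<^sup>2 + (\<bar>b\<bar> ^ n)\<^sup>2"
      using sum_squares_bound[of "\<bar>a\<bar> ^ n" "\<bar>b\<bar> ^ n"] by simp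
    moreover have "0 \<le> \<bar>a\<bar> ^ n * \<bar>b\<bar> ^ n"
      by simp
    ultimately have "\<bar>a\<bar> ^ n * \<bar>b\<bar> ^ n \<le> (\<bar>a\<bar> ^ n)\<^sup>2 + (\<bar>b\<bar> ^ n)\<^sup>2"
      by linarith
    then show ?thesis
      by (simp add: abs_mult power_mult_distrib mult.commute[of 2] flip: power_mult)
  qed
  have "integrable M (\<lambda>\<omega>. \<bar>X \<omega>\<bar> ^ (2 * n) + \<bar>Y \<omega>\<bar> ^ (2 * n))"
    using assms unfolding all_moments_def by (intro Bochner_Integration.integrable_add) blast+
  then show "integrable M (\<lambda>\<omega>. \<bar>X \<omega> * Y \<omega>\<bar> ^ n)"
  proof (rule Bochner_Integration.integrable_bound)
    show "AE \<omega> in M. norm (\<bar>X \<omega> * Y \<omega>\<bar> ^ n) \<le> norm (\<bar>X \<omega>\<bar> ^ (2 * n) + \<bar>Y \<omega>\<bar> ^ (2 * n))"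
    proof (rule AE_I2)
      fix \<omega>
      show "norm (\<bar>X \<omega> * Y \<omega>\<bar> ^ n) \<le> norm (\<bar>X \<omega>\<bar> ^ (2 * n) + \<bar>Y \<omega>\<bar> ^ (2 * n))"
        using le[of "X \<omega>" "Y \<omega>"] by (simp add: abs_of_nonneg)
    qed
  qed simp
qed

lemma (in prob_space) all_moments_sum:
  assumes "\<And>i. i \<in> I \<Longrightarrow> all_moments M (X i)"
  shows "all_moments M (\<lambda>\<omega>. \<Sum>i\<in>I. X i \<omega>)"
  using assms
  by (induction I rule: infinite_finite_induct) (simp_all add: all_moments_const all_moments_add)

lemma (in prob_space) all_moments_prod:
  assumes "\<And>i. i \<in> I \<Longrightarrow> all_moments M (X i)"
  shows "all_moments M (\<lambda>\<omega>. \<Prod>i\<in>I. X i \<omega>)"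
  using assms
  by (induction I rule: infinite_finite_induct) (simp_all add: all_moments_const all_moments_mult)

lemma (in prob_space) all_moments_power:
  assumes "all_moments M X"
  shows "all_moments M (\<lambda>\<omega>. X \<omega> ^ n)"
  using all_moments_prod[of "{..<n}" "\<lambda>_. X"] assms by simp

lemma exp_partial_sum_le:
  fixes x :: real
  assumes "x \<ge> 0"
  shows "(\<Sum>k<n. x ^ k / fact k) \<le> exp x"
  using sum_le_suminf[of "\<lambda>k. x ^ k / fact k" "{..<n}"] assms summable_exp[of x]
  by (auto simp: exp_def field_simps)

text \<open>A single term of the exponential series is at most the whole series, so
  \<open>\<bar>X\<bar> ^ n\<close> is dominated by a multiple of
  \<open>exp (s * \<bar>X\<bar>)\<close>.\<close>

lemma all_moments_exp_moment:
  assumes [measurable]: "X \<in> borel_measurable M" and "exp_moment M X"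
  shows "all_moments M X"
  unfolding all_moments_def
proof safe
  obtain s where s: "s > 0" "integrable M (\<lambda>\<omega>. exp (s * \<bar>X \<omega>\<bar>))"
    using assms unfolding exp_moment_def by auto
  fix n
  have le: "\<bar>a\<bar> ^ n \<le> fact n / s ^ n * exp (s * \<bar>a\<bar>)" for a
  proof -
    have "(s * \<bar>a\<bar>) ^ n / fact n \<le> (\<Sum>k<Suc n. (s * \<bar>a\<bar>) ^ k / fact k)"
      using s by (intro member_le_sum) auto
    also have "\<dots> \<le> exp (s * \<bar>a\<bar>)"
      using s by (intro exp_partial_sum_le) auto
    finally show ?thesis
      using s by (simp add: field_simps)
  qed
  have "integrable M (\<lambda>\<omega>. fact n / s ^ n * exp (s * \<bar>X \<omega>\<bar>))"
    using s by auto
  then show "integrable M (\<lambda>\<omega>. \<bar>X \<omega>\<bar> ^ n)"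
    by (rule Bochner_Integration.integrable_bound) (use le s in auto)
qed fact

section \<open>Generating series of moments\<close>

text \<open>The moment generating function as a formal object: for partial sums, only moments and no
  convergence have to be controlled.\<close>

definition moment_fps :: "'a measure \<Rightarrow> ('a \<Rightarrow> real) \<Rightarrow> real fps" where
  "moment_fps M X = Abs_fps (\<lambda>n. (\<integral>\<omega>. X \<omega> ^ n \<partial>M) / fact n)"

text \<open>Expectation and exponential series may be exchanged for
  \<open>\<bar>z\<bar> < s\<close>, since the partial sums of the absolute values are dominated by
  the integrable \<open>exp (s * \<bar>X\<bar>)\<close>.\<close>

lemma mgf_has_fps_expansion:
  assumes [measurable]: "X \<in> borel_measurable M" and "exp_moment M X"
  shows "(\<lambda>z. \<integral>\<omega>. exp (z * X \<omega>) \<partial>M) has_fps_expansion moment_fps M X"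
  unfolding moment_fps_def
proof (rule has_fps_expansionI_sums)
  obtain s where s: "s > 0" "integrable M (\<lambda>\<omega>. exp (s * \<bar>X \<omega>\<bar>))"
    using assms unfolding exp_moment_def by auto
  have mom: "all_moments M X"
    by (rule all_moments_exp_moment) fact+
  have sums: "(\<lambda>n. (\<integral>\<omega>. X \<omega> ^ n \<partial>M) / fact n * z ^ n) sums (\<integral>\<omega>. exp (z * X \<omega>) \<partial>M)"
    if z: "\<bar>z\<bar> < s" for z
  proof -
    let ?f = "\<lambda>n \<omega>. (z * X \<omega>) ^ n / fact n"
    have f_int: "integrable M (?f n)" for n
      using all_moments_integrable_power[OF mom, of n] by (simp add: power_mult_distrib)
    have "(\<lambda>n. integral\<^sup>L M (?f n)) sums (\<integral>\<omega>. (\<Sum>n. ?f n \<omega>) \<partial>M)"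
    proof (rule sums_integral[OF f_int])
      have "summable (\<lambda>n. norm (?f n \<omega>))" for \<omega>
        using summable_norm_exp[of "z * X \<omega>"] by (simp add: field_simps)
      then show "AE \<omega> in M. summable (\<lambda>n. norm (?f n \<omega>))"
        by simp
      have "(\<Sum>k<n. \<integral>\<omega>. norm (?f k \<omega>) \<partial>M) \<le> (\<integral>\<omega>. exp (s * \<bar>X \<omega>\<bar>) \<partial>M)" for n
      proof -
        have "(\<Sum>k<n. \<integral>\<omega>. norm (?f k \<omega>) \<partial>M) = (\<integral>\<omega>. (\<Sum>k<n. norm (?f k \<omega>)) \<partial>M)"
          by (rule Bochner_Integration.integral_sum[symmetric]) (intro integrable_norm f_int)
        also have "\<dots> \<le> (\<integral>\<omega>. exp (s * \<bar>X \<omega>\<bar>) \<partial>M)"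
        proof (rule integral_mono)
          show "integrable M (\<lambda>\<omega>. \<Sum>k<n. norm (?f k \<omega>))"
            by (intro Bochner_Integration.integrable_sum integrable_norm f_int)
          fix \<omega>
          have "(\<Sum>k<n. norm (?f k \<omega>)) = (\<Sum>k<n. (\<bar>z\<bar> * \<bar>X \<omega>\<bar>) ^ k / fact k)"
            by (simp add: power_abs abs_mult)
          also have "\<dots> \<le> exp (\<bar>z\<bar> * \<bar>X \<omega>\<bar>)"
            by (intro exp_partial_sum_le) auto
          also have "\<dots> \<le> exp (s * \<bar>X \<omega>\<bar>)"
            using z by (simp add: mult_right_mono)
          finally show "(\<Sum>k<n. norm (?f k \<omega>)) \<le> exp (s * \<bar>X \<omega>\<bar>)" .
        qed (fact s)
        finally show ?thesis .
      qed
      then show "summable (\<lambda>n. \<integral>\<omega>. norm (?f n \<omega>) \<partial>M)"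
        by (intro summableI_nonneg_bounded) auto
    qed
    moreover have "(\<Sum>n. ?f n \<omega>) = exp (z * X \<omega>)" for \<omega>
      by (simp add: exp_def field_simps)
    moreover have "integral\<^sup>L M (?f n) = (\<integral>\<omega>. X \<omega> ^ n \<partial>M) / fact n * z ^ n" for n
      by (simp add: power_mult_distrib)
    ultimately show ?thesis by simp
  qed
  then show "\<forall>\<^sub>F z in nhds 0. (\<lambda>n. (\<integral>\<omega>. X \<omega> ^ n \<partial>M) / fact n * z ^ n) sums
                               (\<integral>\<omega>. exp (z * X \<omega>) \<partial>M)"
    using s by (auto simp: eventually_nhds_metric dist_real_def)
qed

lemma (in prob_space) moment_fps_0: "fps_nth (moment_fps M X) 0 = 1"
  by (simp add: moment_fps_def prob_space)

text \<open>Independence factors each mixed moment in the binomial expansion, and dividing by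
  \<open>fact n\<close> turns that expansion into a Cauchy product.\<close>

lemma (in prob_space) moment_fps_add:
  assumes indep: "indep_var borel X borel Y" and "all_moments M X" "all_moments M Y"
  shows "moment_fps M (\<lambda>\<omega>. X \<omega> + Y \<omega>) = moment_fps M X * moment_fps M Y"
proof (rule fps_ext)
  fix n
  have ind: "indep_var borel (\<lambda>\<omega>. X \<omega> ^ k) borel (\<lambda>\<omega>. Y \<omega> ^ i)" for k i
    using indep_var_compose[OF indep, of "\<lambda>u. u ^ k" borel "\<lambda>u. u ^ i" borel]
    by (simp add: comp_def)
  note int = all_moments_integrable_power[OF assms(2)] all_moments_integrable_power[OF assms(3)]
  have "expectation (\<lambda>\<omega>. (X \<omega> + Y \<omega>) ^ n) =
        expectation (\<lambda>\<omega>. \<Sum>k\<le>n. real (n choose k) * (X \<omega> ^ k * Y \<omega> ^ (n - k)))"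
    by (simp add: binomial_ring mult.assoc)
  also have "\<dots> = (\<Sum>k\<le>n. real (n choose k) * (expectation (\<lambda>\<omega>. X \<omega> ^ k) * expectation (\<lambda>\<omega>. Y \<omega> ^ (n - k))))"
    by (simp add: indep_var_integrable[OF ind int] indep_var_lebesgue_integral[OF ind int])
  finally show "fps_nth (moment_fps M (\<lambda>\<omega>. X \<omega> + Y \<omega>)) n = fps_nth (moment_fps M X * moment_fps M Y) n"
    by (simp add: moment_fps_def fps_mult_nth sum_divide_distrib atLeast0AtMost binomial_fact)
qed

lemma moment_fps_partial_sum:
  assumes N: "prob_space N" and Z: "independent_copies N Z M Y"
    and Y: "Y \<in> borel_measurable M" "all_moments M Y"
  shows "moment_fps N (partial_sum Z k) = moment_fps M Y ^ k"
proof -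
  interpret N: prob_space N by (fact N)
  have indep: "N.indep_vars (\<lambda>_. borel) Z {1..}"
    and distr: "\<And>l. l \<ge> 1 \<Longrightarrow> distr N borel (Z l) = distr M borel Y"
    using Z by (auto simp: independent_copies_def)
  have rv: "Z l \<in> borel_measurable N" if "l \<ge> 1" for l
    using indep that by (auto simp: N.indep_vars_def)
  \<comment> \<open>The copies and \<open>Y\<close> may live on different spaces, so moments are
    transferred through the common distribution.\<close>
  have eq: "(\<integral>\<omega>. g (Z l \<omega>) \<partial>N) = (\<integral>\<omega>. g (Y \<omega>) \<partial>M)"
    if "l \<ge> 1" "g \<in> borel_measurable borel" for l and g :: "real \<Rightarrow> real"
    using integral_distr[OF rv[OF that(1)] that(2)] integral_distr[OF Y(1) that(2)] distr[OF that(1)]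
    by simp
  have mom: "all_moments N (Z l)" if "l \<ge> 1" for l
    unfolding all_moments_def
  proof safe
    fix n
    show "integrable N (\<lambda>\<omega>. \<bar>Z l \<omega>\<bar> ^ n)"
      using integrable_distr_eq[OF rv[OF that], of "\<lambda>u. \<bar>u\<bar> ^ n"]
        integrable_distr_eq[OF Y(1), of "\<lambda>u. \<bar>u\<bar> ^ n"] distr[OF that] Y(2)
      by (simp add: all_moments_def)
  qed (use rv that in auto)
  show ?thesis
  proof (induction k)
    case 0
    show ?case
      \<comment> \<open>The empty sum is 0; its moment of order 0 is 1 by the convention
        \<open>0 ^ 0 = 1\<close>, so its series is 1.\<close>
      by (auto simp: moment_fps_def partial_sum_def fps_eq_iff power_0_left N.prob_space)
  next
    case (Suc k)
    have "N.indep_var borel (Z (Suc k)) borel (partial_sum Z k)"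
      unfolding partial_sum_def
      by (rule N.indep_vars_sum) (auto intro: N.indep_vars_subset[OF indep])
    moreover have "all_moments N (partial_sum Z k)"
      unfolding partial_sum_def by (rule N.all_moments_sum) (auto intro: mom)
    ultimately have "moment_fps N (\<lambda>\<omega>. Z (Suc k) \<omega> + partial_sum Z k \<omega>) =
        moment_fps N (Z (Suc k)) * moment_fps N (partial_sum Z k)"
      by (intro N.moment_fps_add mom) auto
    moreover have "partial_sum Z (Suc k) = (\<lambda>\<omega>. Z (Suc k) \<omega> + partial_sum Z k \<omega>)"
      by (auto simp: partial_sum_def)
    moreover have "moment_fps N (Z (Suc k)) = moment_fps M Y"
      using eq[of "Suc k" "\<lambda>u. u ^ i" for i] by (simp add: moment_fps_def)
    ultimately show ?case
      using Suc by simp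
  qed
qed

text \<open>Both the given series and the formal quotient expand the same function near 0, hence
  they agree. The quotient exists because the moment series has constant coefficient 1.\<close>

lemma appell_sequence_fps:
  assumes M: "prob_space M" and Y: "Y \<in> borel_measurable M" "exp_moment M Y"
    and A: "appell_sequence M Y A"
  shows "Abs_fps (\<lambda>n. poly (A n) x / fact n) * moment_fps M Y = fps_exp x"
proof -
  interpret prob_space M by (fact M)
  let ?E = "\<lambda>z. \<integral>\<omega>. exp (z * Y \<omega>) \<partial>M"
  have E: "?E has_fps_expansion moment_fps M Y"
    by (rule mgf_has_fps_expansion) fact+
  have "(\<lambda>z. exp (x * z) / ?E z) has_fps_expansion Abs_fps (\<lambda>n. poly (A n) x / fact n)"
    using A by (intro has_fps_expansionI_sums) (simp add: appell_sequence_def)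
  moreover have "(\<lambda>z. exp (x * z) / ?E z) has_fps_expansion fps_exp x / moment_fps M Y"
    by (intro has_fps_expansion_divide' has_fps_expansion_exp E) (simp add: moment_fps_0)
  ultimately have "Abs_fps (\<lambda>n. poly (A n) x / fact n) = fps_exp x / moment_fps M Y"
    by (rule has_fps_expansion_unique)
  then show ?thesis
    using moment_fps_0[of Y] by (simp add: fps_divide_unit inverse_mult_eq_1 mult.assoc)
qed

section \<open>Integration over the random vector\<close>

theorem theorem5:
  fixes m n :: nat and x :: "nat \<Rightarrow> real"
    and A :: "nat \<Rightarrow> nat \<Rightarrow> real poly"
    and M :: "'a measure" and Y :: "nat \<Rightarrow> 'a \<Rightarrow> real"
    and N :: "'b measure" and Z :: "nat \<Rightarrow> nat \<Rightarrow> 'b \<Rightarrow> real"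
    and P :: "'c measure" and W :: "nat \<Rightarrow> 'c \<Rightarrow> real"
  assumes "m \<ge> 1"
    and "prob_space M" and "prob_space N" and "prob_space P"
    and "prob_space.indep_vars M (\<lambda>_. borel) Y {1..m}"
    and "\<And>j. j \<in> {1..m} \<Longrightarrow> exp_moment M (Y j)"
    and "\<And>j. j \<in> {1..m} \<Longrightarrow> appell_sequence M (Y j) (A j)"
    and "\<And>j. j \<in> {1..m} \<Longrightarrow> independent_copies N (Z j) M (Y j)"
    and "\<And>j. j \<in> {1..m} \<Longrightarrow> W j \<in> borel_measurable P"
    and "\<And>j. j \<in> {1..m} \<Longrightarrow> exp_moment P (W j)"
  shows "(\<Sum>j\<in>multi_indices m n.
            multinomial m n j * (\<integral>\<omega>. (\<Prod>l=1..m. W l \<omega> ^ j l) \<partial>P) *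
            (\<Prod>l=1..m. poly (A l (j l)) (x l))) =
         (\<Sum>r=0..n. real (n choose r) *
            (\<Sum>k=0..r. real ((r + 1) choose (k + 1)) * (-1) ^ k *
               (\<Sum>i\<in>multi_indices m r.
                  multinomial m r i *
                  (\<integral>\<omega>. (\<Prod>l=1..m. W l \<omega> ^ i l) * (\<Sum>l=1..m. x l * W l \<omega>) ^ (n - r) \<partial>P) *
                  (\<Prod>l=1..m. \<integral>\<omega>. partial_sum (Z l) k \<omega> ^ i l \<partial>N))))"
proof -
  interpret M: prob_space M by fact
  interpret P: prob_space P by fact
  define F where "F l = moment_fps M (Y l)" for l
  define G where "G l = Abs_fps (\<lambda>n. poly (A l n) (x l) / fact n)" for l
  have Y: "Y l \<in> borel_measurable M" if "l \<in> {1..m}" for l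
    using assms(5) that by (auto simp: M.indep_vars_def)
  have Ymom: "all_moments M (Y l)" if "l \<in> {1..m}" for l
    using Y assms(6) that by (intro all_moments_exp_moment) auto
  have GF: "G l * F l = fps_exp (x l)" if "l \<in> {1..m}" for l
    unfolding F_def G_def using assms that Y by (intro appell_sequence_fps) auto
  have F0: "fps_nth (F l) 0 = 1" for l
    by (simp add: F_def M.moment_fps_0)
  have S: "(\<Prod>l=1..m. \<integral>\<omega>. partial_sum (Z l) k \<omega> ^ i l \<partial>N) =
           (\<Prod>l=1..m. fact (i l) * fps_nth (F l ^ k) (i l))" for k i
  proof (rule prod.cong[OF refl])
    fix l assume l: "l \<in> {1..m}"
    show "(\<integral>\<omega>. partial_sum (Z l) k \<omega> ^ i l \<partial>N) = fact (i l) * fps_nth (F l ^ k) (i l)"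
      unfolding F_def moment_fps_partial_sum[OF assms(3) assms(8)[OF l] Y[OF l] Ymom[OF l], symmetric]
      by (simp add: moment_fps_def)
  qed
  have G: "(\<Prod>l=1..m. poly (A l (j l)) (x l)) = (\<Prod>l=1..m. fact (j l) * fps_nth (G l) (j l))" for j
    by (simp add: G_def)
  have Wmom: "all_moments P (W l)" if "l \<in> {1..m}" for l
    using assms(9,10) that by (intro all_moments_exp_moment) auto
  \<comment> \<open>Integrability of every term licenses the exchange of expectation and finite sums
    on both sides.\<close>
  have int1: "integrable P (\<lambda>\<omega>. \<Prod>l=1..m. W l \<omega> ^ j l)" for j
    by (intro all_moments_integrable P.all_moments_prod P.all_moments_power Wmom)
  have int2: "integrable P (\<lambda>\<omega>. (\<Prod>l=1..m. W l \<omega> ^ j l) * (\<Sum>l=1..m. x l * W l \<omega>) ^ q)" for j q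
    by (intro all_moments_integrable P.all_moments_prod P.all_moments_power Wmom
        all_moments_mult P.all_moments_sum P.all_moments_const)
  have "(\<Sum>j\<in>multi_indices m n.
            multinomial m n j * (\<integral>\<omega>. (\<Prod>l=1..m. W l \<omega> ^ j l) \<partial>P) *
            (\<Prod>l=1..m. poly (A l (j l)) (x l))) =
        (\<integral>\<omega>. (\<Sum>j\<in>multi_indices m n. multinomial m n j * (\<Prod>l=1..m. W l \<omega> ^ j l) *
             (\<Prod>l=1..m. fact (j l) * fps_nth (G l) (j l))) \<partial>P)"
    unfolding G by (simp add: int1 del: One_nat_def)
  \<comment> \<open>The deterministic identity is used under the integral, with
    \<open>W l \<omega>\<close> in place of \<open>w l\<close>.\<close>
  also have "\<dots> = (\<integral>\<omega>. (\<Sum>r=0..n. real (n choose r) *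
            (\<Sum>k=0..r. real ((r + 1) choose (k + 1)) * (-1) ^ k *
               (\<Sum>i\<in>multi_indices m r.
                  multinomial m r i * ((\<Prod>l=1..m. W l \<omega> ^ i l) * (\<Sum>l=1..m. x l * W l \<omega>) ^ (n - r)) *
                  (\<Prod>l=1..m. fact (i l) * fps_nth (F l ^ k) (i l))))) \<partial>P)"
    by (subst multinomial_appell_identity[OF GF F0]) simp_all
  also have "\<dots> = (\<Sum>r=0..n. real (n choose r) *
            (\<Sum>k=0..r. real ((r + 1) choose (k + 1)) * (-1) ^ k *
               (\<Sum>i\<in>multi_indices m r.
                  multinomial m r i *
                  (\<integral>\<omega>. (\<Prod>l=1..m. W l \<omega> ^ i l) * (\<Sum>l=1..m. x l * W l \<omega>) ^ (n - r) \<partial>P) *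
                  (\<Prod>l=1..m. fact (i l) * fps_nth (F l ^ k) (i l)))))"
    by (simp add: int2 del: One_nat_def)
  finally show ?thesis
    unfolding S .
qed

end
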